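(* Every Sturmian morphism different from $E$ and $Id$ is quasiperiodic; that is, for every Sturmian morphism $f\notin\{E,Id\}$ there exists a non-quasiperiodic infinite word $w$ over $\{a,b\}$ such that $f(w)$ is quasiperiodic.
   Context: The morphisms on $\{a,b\}^*$ (extended letterwise to infinite words) are: $E: a\mapsto b,\ b\mapsto a$; $L_a: a\mapsto a,\ b\mapsto ab$; $L_b: a\mapsto ba,\ b\mapsto b$; $R_a: a\mapsto a,\ b\mapsto ba$; $R_b: a\mapsto ab,\ b\mapsto b$; $Id$ is the identity. The Sturmian morphisms (the morphisms mapping every Sturmian word to a Sturmian word, where a Sturmian word is an infinite balanced non-ultimately-periodic word over $\{a,b\}$) are exactly the finite compositions of elements of $\{E,L_a,L_b,R_a,R_b\}$ (including $Id$), by a theorem of Séébold. An infinite (i.e. right-infinite) word $w$ is quasiperiodic if there exist a finite word $u$ and finite words $(p_n)_{n\ge 0}$ with $p_0=\varepsilon$ such that, for all $n\ge 0$, $0<|p_{n+1}|-|p_n|\le |u|$ and $p_nu$ is a prefix of $w$. *)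

theory Defs
  imports "HOL-Library.Stream"
begin

datatype letter = A | B

definition is_prefix :: "'a list \<Rightarrow> 'a stream \<Rightarrow> bool" where
  "is_prefix u w \<longleftrightarrow> (\<exists>s. w = u @- s)"

definition is_factor :: "'a list \<Rightarrow> 'a stream \<Rightarrow> bool" where
  "is_factor u w \<longleftrightarrow> (\<exists>p s. w = p @- u @- s)"

definition ultimately_periodic :: "'a stream \<Rightarrow> bool" where
  "ultimately_periodic w \<longleftrightarrow> (\<exists>u v. v \<noteq> [] \<and> w = u @- cycle v)"

definition balanced :: "letter stream \<Rightarrow> bool" where
  "balanced w \<longleftrightarrow>
     (\<forall>u v. is_factor u w \<longrightarrow> is_factor v w \<longrightarrow> length u = length v \<longrightarrow>
        \<bar>int (count_list u A) - int (count_list v A)\<bar> \<le> 1)"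

definition sturmian :: "letter stream \<Rightarrow> bool" where
  "sturmian w \<longleftrightarrow> balanced w \<and> \<not> ultimately_periodic w"

definition quasiperiodic :: "'a stream \<Rightarrow> bool" where
  "quasiperiodic w \<longleftrightarrow>
     (\<exists>u (p :: nat \<Rightarrow> 'a list). p 0 = [] \<and>
        (\<forall>n. 0 < int (length (p (Suc n))) - int (length (p n)) \<and>
             int (length (p (Suc n))) - int (length (p n)) \<le> int (length u) \<and>
             is_prefix (p n @ u) w))"

definition morphism :: "('a list \<Rightarrow> 'b list) \<Rightarrow> bool" where
  "morphism f \<longleftrightarrow> (\<forall>u v. f (u @ v) = f u @ f v)"

text \<open>
  The extension of a morphism to infinite words is given as a relation: \<open>maps_to f w v\<close> says
  that the letterwise image of \<open>w\<close> is the infinite word \<open>v\<close>.  If \<open>f\<close> erases letters, that image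
  may be a finite word, in which case no \<open>v\<close> qualifies.
\<close>

definition maps_to :: "('a list \<Rightarrow> 'b list) \<Rightarrow> 'a stream \<Rightarrow> 'b stream \<Rightarrow> bool" where
  "maps_to f w v \<longleftrightarrow>
     (\<forall>n. is_prefix (f (stake n w)) v) \<and> (\<forall>m. \<exists>n. m \<le> length (f (stake n w)))"

lemma is_prefix_stake: "is_prefix u w \<longleftrightarrow> stake (length u) w = u"
  unfolding is_prefix_def by (metis length_stake stake_sdrop stake_shift order_refl
      diff_self_eq_0 stake.simps(1) append_Nil2 take_all)

lemma maps_to_unique:
  assumes "maps_to f w v" and "maps_to f w v'"
  shows "v = v'"
proof -
  have "v !! i = v' !! i" for i
  proof -
    obtain n where n: "Suc i \<le> length (f (stake n w))"
      using assms(1) unfolding maps_to_def by blast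
    have "stake (length (f (stake n w))) v = stake (length (f (stake n w))) v'"
      using assms unfolding maps_to_def is_prefix_stake by metis
    with n show ?thesis
      by (metis Suc_le_lessD stake_nth)
  qed
  then show ?thesis
    by (metis eqTrueI smap_alt stream.map_id)
qed

definition sturmian_morphism :: "(letter list \<Rightarrow> letter list) \<Rightarrow> bool" where
  "sturmian_morphism f \<longleftrightarrow>
     morphism f \<and> (\<forall>w. sturmian w \<longrightarrow> (\<exists>v. maps_to f w v \<and> sturmian v))"

definition quasiperiodic_morphism :: "(letter list \<Rightarrow> letter list) \<Rightarrow> bool" where
  "quasiperiodic_morphism f \<longleftrightarrow>
     (\<exists>w v. \<not> quasiperiodic w \<and> maps_to f w v \<and> quasiperiodic v)"

definition E :: "letter list \<Rightarrow> letter list" where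
  "E = map (\<lambda>x. case x of A \<Rightarrow> B | B \<Rightarrow> A)"

end

theory Submission
  imports Defs "HOL-Library.Sublist" "HOL-Analysis.Continuum_Not_Denumerable"
begin

text \<open>
  Let \<open>x\<close> and \<open>y\<close> be the images of the two letters under a Sturmian morphism \<open>f\<close>. If one of them,
  say \<open>x\<close>, is a prefix of the other, \<open>y = xz\<close>, then \<open>f\<close> maps the non-quasiperiodic word \<open>bab\<^sup>\<omega>\<close> to
  \<open>xzx(xz)\<^sup>\<omega>\<close>, which is covered by \<open>xzx\<close>; if \<open>y = zx\<close>, then \<open>f\<close> maps \<open>ab\<^sup>\<omega>\<close> to \<open>x(zx)\<^sup>\<omega>\<close>, which
  is periodic. So it suffices that \<open>x\<close> and \<open>y\<close> are comparable in this sense unless \<open>f\<close> is \<open>E\<close> or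
  the identity. This is shown by induction on \<open>|x| + |y|\<close>, with the factors of just two bi-infinite
  mechanical words, one containing \<open>baaab\<close> and the other \<open>abbba\<close>. Balance of their images either
  forbids \<open>bb\<close> (up to \<open>E\<close>), so that \<open>x\<close> and \<open>y\<close> both start or both end with \<open>a\<close> and \<open>f\<close> factors
  on the left through \<open>L\<^sub>a\<close> or \<open>R\<^sub>a\<close>, or makes \<open>x\<close> and \<open>y\<close> alternating words. Two-sided extendability
  of the languages is what makes balance pass back through \<open>R\<^sub>a\<close>.
\<close>

section \<open>Swapping the letters\<close>

lemma neq_A [simp]: "c \<noteq> A \<longleftrightarrow> c = B" and neq_B [simp]: "c \<noteq> B \<longleftrightarrow> c = A"
  by (cases c; simp)+

abbreviation flip :: "letter \<Rightarrow> letter" where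
  "flip c \<equiv> (case c of A \<Rightarrow> B | B \<Rightarrow> A)"

lemma flip_flip [simp]: "flip (flip c) = c"
  by (cases c) auto

lemma E_simps [simp]:
  "E [] = []" "E (c # u) = flip c # E u" "E (u @ v) = E u @ E v" "length (E u) = length u"
  "E u = [] \<longleftrightarrow> u = []"
  by (auto simp: E_def)

lemma E_E [simp]: "E (E u) = u"
  by (induction u) auto

lemma E_eq_iff: "E u = v \<longleftrightarrow> u = E v"
  by auto

lemma count_A_B: "count_list u A + count_list u B = length u"
  by (induction u) auto

lemma count_E: "count_list (E u) A = count_list u B"
  by (induction u) (auto split: letter.splits)

lemma sublist_E_iff: "sublist (E u) v \<longleftrightarrow> sublist u (E v)"
  unfolding sublist_def by (metis E_E E_simps(3))

lemma prefix_E_iff [simp]: "prefix (E u) (E v) \<longleftrightarrow> prefix u v"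
  unfolding prefix_def by (metis E_E E_simps(3))

lemma suffix_E_iff [simp]: "suffix (E u) (E v) \<longleftrightarrow> suffix u v"
  unfolding suffix_def by (metis E_E E_simps(3))

text \<open>A morphism is encoded by the images \<open>x\<close> and \<open>y\<close> of the two
  letters, so that the induction can run over pairs of words.\<close>

definition image2 :: "'a list \<Rightarrow> 'a list \<Rightarrow> letter list \<Rightarrow> 'a list" where
  "image2 x y u = concat (map (case_letter x y) u)"

lemma image2_simps [simp]:
  "image2 x y [] = []"
  "image2 x y (c # u) = (case c of A \<Rightarrow> x | B \<Rightarrow> y) @ image2 x y u"
  "image2 x y (u @ v) = image2 x y u @ image2 x y v"
  by (auto simp: image2_def split: letter.splits)

lemma image2_image2: "image2 p q (image2 x y u) = image2 (image2 p q x) (image2 p q y) u"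
  by (induction u) (auto split: letter.splits)

lemma E_image2: "E (image2 x y u) = image2 (E x) (E y) u"
  by (induction u) (auto split: letter.splits)

section \<open>Balanced sets of words\<close>

text \<open>The two factors may come from different members of \<open>S\<close>, so this is balance
  of a whole language. A one-sided inequality suffices because the two factors can be
  exchanged.\<close>

definition balanced_set :: "letter list set \<Rightarrow> bool" where
  "balanced_set S \<longleftrightarrow>
     (\<forall>s\<in>S. \<forall>t\<in>S. \<forall>u v. sublist u s \<longrightarrow> sublist v t \<longrightarrow> length u = length v \<longrightarrow>
        count_list u A \<le> Suc (count_list v A))"

lemma balanced_setD:
  "balanced_set S \<Longrightarrow> s \<in> S \<Longrightarrow> t \<in> S \<Longrightarrow> sublist u s \<Longrightarrow> sublist v t \<Longrightarrow>
     length u = length v \<Longrightarrow> count_list u A \<le> Suc (count_list v A)"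
  unfolding balanced_set_def by blast

text \<open>For words of equal length, an excess of \<open>A\<close> is a deficit of
  \<open>B\<close>; hence the inequality for \<open>u\<close> and \<open>v\<close> is the one for
  \<open>E v\<close> and \<open>E u\<close>.\<close>

lemma balanced_set_E:
  assumes "balanced_set S"
  shows "balanced_set (E ` S)"
proof -
  have "count_list u A \<le> Suc (count_list v A)"
    if "s \<in> S" "t \<in> S" "sublist u (E s)" "sublist v (E t)" "length u = length v" for s t u v
  proof -
    have "count_list (E v) A \<le> Suc (count_list (E u) A)"
      using balanced_setD[OF assms that(2,1), of "E v" "E u"] that by (simp add: sublist_E_iff)
    then show ?thesis
      using count_A_B[of u] count_A_B[of v] that(5) by (simp add: count_E)
  qed
  then show ?thesis
    unfolding balanced_set_def by auto
qed

lemma balanced_set_image2_E: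
  assumes "balanced_set (image2 x y ` F)"
  shows "balanced_set (image2 (E x) (E y) ` F)"
  using balanced_set_E[OF assms] by (simp add: image_image E_image2)

lemma balanced_set_squares:
  assumes "balanced_set S" "s \<in> S" "sublist [A, A] s" "sublist [B, B] s"
  shows False
  using balanced_setD[OF assms(1,2,2,3,4)] by simp

section \<open>Desubstitution\<close>

abbreviation La :: "letter list \<Rightarrow> letter list" where
  "La \<equiv> image2 [A] [A, B]"

abbreviation Ra :: "letter list \<Rightarrow> letter list" where
  "Ra \<equiv> image2 [A] [B, A]"

text \<open>\<open>La\<close> and \<open>Ra\<close> are conjugate by the letter \<open>A\<close>;
  this lets one desubstitution argument serve both.\<close>

lemma La_append_A: "La u @ [A] = A # Ra u"
  by (induction u) (auto split: letter.splits)

lemma count_La [simp]: "count_list (La u) A = length u"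
  by (induction u) (auto split: letter.splits)

lemma length_La [simp]: "length (La u) = length u + count_list u B"
  by (induction u) (auto split: letter.splits)

lemma length_Ra [simp]: "length (Ra u) = length u + count_list u B"
  by (induction u) (auto split: letter.splits)

lemma La_Ra_common:
  assumes "u \<noteq> []"
  obtains v where "La u = A # v" "Ra u = v @ [A]"
proof -
  obtain v where v: "La u = A # v"
    using assms by (cases u; cases "hd u") auto
  with La_append_A[of u] have "Ra u = v @ [A]" by simp
  with v that show ?thesis by blast
qed

text \<open>The inner factor \<open>v\<close> of \<open>La u\<close> is poor in \<open>A\<close>, while \<open>La u' @ [A]\<close> is rich in \<open>A\<close>:
  the imbalance of \<open>u\<close> and \<open>u'\<close> is inherited by these two words.\<close>

lemma balanced_set_desubstitute:
  assumes bal: "balanced_set T"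
    and inner: "\<And>s u v. s \<in> S \<Longrightarrow> sublist u s \<Longrightarrow> La u = A # v \<Longrightarrow> Ra u = v @ [A] \<Longrightarrow>
      \<exists>t\<in>T. sublist v t"
    and outer: "\<And>s u. s \<in> S \<Longrightarrow> sublist u s \<Longrightarrow> \<exists>t\<in>T. sublist (La u @ [A]) t"
  shows "balanced_set S"
  unfolding balanced_set_def
proof (intro ballI allI impI, rule ccontr)
  fix s t u u'
  assume st: "s \<in> S" "t \<in> S" and u: "sublist u' s" "sublist u t" "length u' = length u"
    and "\<not> count_list u' A \<le> Suc (count_list u A)"
  then have d: "count_list u' B + 2 \<le> count_list u B"
    using count_A_B[of u] count_A_B[of u'] by linarith
  then have "u \<noteq> []" by auto
  then obtain v where v: "La u = A # v" "Ra u = v @ [A]"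
    by (rule La_Ra_common)
  \<comment> \<open>As \<open>u\<close> has at least two more \<open>B\<close> than
    \<open>u'\<close>, the word \<open>v\<close> can be cut to the length of
    \<open>La u' @ [A]\<close>. The cut word has at most \<open>length u - 1\<close> letters
    \<open>A\<close>, the other one has \<open>length u + 1\<close>.\<close>
  define w where "w = take (length (La u' @ [A])) v"
  obtain t1 where t1: "t1 \<in> T" "sublist v t1"
    using inner[OF st(2) u(2) v] by blast
  then have w: "sublist w t1"
    unfolding w_def by (meson sublist_order.order.trans sublist_take)
  obtain t2 where t2: "t2 \<in> T" "sublist (La u' @ [A]) t2"
    using outer[OF st(1) u(1)] by blast
  have "length v + 1 = length (La u)" using v by simp
  then have "length w = length (La u' @ [A])"
    using d u(3) unfolding w_def by simp
  then have "count_list (La u' @ [A]) A \<le> Suc (count_list w A)"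
    using balanced_setD[OF bal t2(1) t1(1) t2(2) w] by simp
  moreover have "count_list w A \<le> count_list v A"
    unfolding w_def by (metis append_take_drop_id count_list_append le_add1)
  moreover have "count_list v A + 1 = length u"
    using arg_cong[OF v(1), of "\<lambda>z. count_list z A"] by simp
  ultimately show False using u(3) by simp
qed

text \<open>The factors of a bi-infinite word have this property; the right extension serves
  \<open>La\<close>, the left extension \<open>Ra\<close>.\<close>

definition extendable :: "'a list set \<Rightarrow> bool" where
  "extendable F \<longleftrightarrow> (\<forall>u\<in>F. (\<exists>c. u @ [c] \<in> F) \<and> (\<exists>c. c # u \<in> F))"

lemma sublist_image2: "sublist u v \<Longrightarrow> sublist (image2 x y u) (image2 x y v)"
  unfolding sublist_def by fastforce

text \<open>The \<open>A\<close> required after \<open>La u\<close> may lie beyond the end of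
  \<open>La s\<close>; it is then the first letter of the nonempty image of a letter
  \<open>c\<close> that extends \<open>s0\<close> to the right.\<close>

lemma balanced_set_La:
  assumes F: "extendable F" and "x \<noteq> []" "y \<noteq> []"
    and bal: "balanced_set (image2 (La x) (La y) ` F)"
  shows "balanced_set (image2 x y ` F)"
proof (rule balanced_set_desubstitute[OF bal])
  fix s u v assume s: "s \<in> image2 x y ` F" "sublist u s" and "La u = A # v"
  have "sublist (La u) (La s)" using s(2) by (rule sublist_image2)
  moreover have "sublist v (La u)" using \<open>La u = A # v\<close> by (metis list.sel(3) sublist_tl)
  ultimately have "sublist v (La s)" by (meson sublist_order.order.trans)
  then show "\<exists>t\<in>image2 (La x) (La y) ` F. sublist v t"
    using s(1) by (auto simp: image2_image2)
next
  fix s u assume "s \<in> image2 x y ` F" and u: "sublist u s"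
  then obtain s0 where s0: "s0 \<in> F" "s = image2 x y s0" by blast
  then obtain c where c: "s0 @ [c] \<in> F" using F unfolding extendable_def by blast
  have "image2 x y [c] \<noteq> []" using assms(2,3) by (cases c) auto
  then obtain v where v: "La (image2 x y [c]) = A # v" by (rule La_Ra_common)
  obtain p q where pq: "s = p @ u @ q" using u unfolding sublist_def by blast
  obtain r where r: "La q @ [A] = A # r" using La_append_A by blast
  have "image2 (La x) (La y) (s0 @ [c]) = La s @ La (image2 x y [c])"
    using s0(2) by (cases c) (simp_all add: image2_image2)
  also have "\<dots> = La p @ La u @ (La q @ [A]) @ v"
    using v pq by simp
  also have "\<dots> = La p @ (La u @ [A]) @ r @ v"
    unfolding r by simp
  finally show "\<exists>t\<in>image2 (La x) (La y) ` F. sublist (La u @ [A]) t"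
    using c unfolding sublist_def by (metis imageI)
qed

text \<open>By conjugacy \<open>La u @ [A]\<close> is \<open>A # Ra u\<close>, so an
  \<open>A\<close> is required before \<open>Ra u\<close>. It ends \<open>Ra p\<close> or, if
  \<open>p\<close> is empty, the image of a letter extending \<open>s0\<close> to the left.\<close>

lemma balanced_set_Ra:
  assumes F: "extendable F" and "x \<noteq> []" "y \<noteq> []"
    and bal: "balanced_set (image2 (Ra x) (Ra y) ` F)"
  shows "balanced_set (image2 x y ` F)"
proof (rule balanced_set_desubstitute[OF bal])
  fix s u v assume s: "s \<in> image2 x y ` F" "sublist u s" and "Ra u = v @ [A]"
  have "sublist (Ra u) (Ra s)" using s(2) by (rule sublist_image2)
  moreover have "sublist v (Ra u)" using \<open>Ra u = v @ [A]\<close> by simp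
  ultimately have "sublist v (Ra s)" by (meson sublist_order.order.trans)
  then show "\<exists>t\<in>image2 (Ra x) (Ra y) ` F. sublist v t"
    using s(1) by (auto simp: image2_image2)
next
  fix s u assume "s \<in> image2 x y ` F" and u: "sublist u s"
  then obtain s0 where s0: "s0 \<in> F" "s = image2 x y s0" by blast
  then obtain c where c: "c # s0 \<in> F" using F unfolding extendable_def by blast
  have "image2 x y [c] \<noteq> []" using assms(2,3) by (cases c) auto
  then obtain v where v: "Ra (image2 x y [c]) = v @ [A]" by (rule La_Ra_common)
  obtain p q where pq: "s = p @ u @ q" using u unfolding sublist_def by blast
  have r: "A # Ra p = La p @ [A]" using La_append_A by metis
  have "image2 (Ra x) (Ra y) (c # s0) = Ra (image2 x y [c]) @ Ra s"
    using s0(2) by (cases c) (simp_all add: image2_image2)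
  also have "\<dots> = v @ (A # Ra p) @ Ra u @ Ra q"
    using v pq by simp
  also have "\<dots> = (v @ La p) @ (La u @ [A]) @ Ra q"
    unfolding r by (simp add: La_append_A)
  finally show "\<exists>t\<in>image2 (Ra x) (Ra y) ` F. sublist (La u @ [A]) t"
    using c unfolding sublist_def by (metis imageI)
qed

text \<open>Every \<open>B\<close> is preceded by an \<open>A\<close>, so the word splits into
  blocks \<open>A\<close> and \<open>AB\<close>; the induction peels off the first block.\<close>

lemma La_preimage:
  assumes "\<not> sublist [B, B] x" "x = [] \<or> hd x = A"
  shows "\<exists>z. x = La z"
  using assms
proof (induction "length x" arbitrary: x rule: less_induct)
  case less
  show ?case
  proof (cases x)
    case Nil
    then show ?thesis by (intro exI[of _ "[]"]) simp
  next
    case (Cons c t)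
    then have [simp]: "c = A" using less.prems by auto
    show ?thesis
    proof (cases "t = [] \<or> hd t = A")
      case True
      moreover have "\<not> sublist [B, B] t" using less.prems(1) Cons by (simp add: sublist_Cons_right)
      ultimately obtain z where "t = La z" using less.hyps[of t] Cons by auto
      then show ?thesis using Cons by (intro exI[of _ "A # z"]) simp
    next
      case False
      then obtain r where t: "t = B # r" by (cases t) auto
      have "\<not> sublist [B, B] r" "r = [] \<or> hd r = A"
        using less.prems(1) Cons t by (cases r; auto simp: sublist_Cons_right)+
      then obtain z where "r = La z" using less.hyps[of r] Cons t by auto
      then show ?thesis using Cons t by (intro exI[of _ "B # z"]) simp
    qed
  qed
qed

lemma rev_La: "rev (La u) = Ra (rev u)"
  by (induction u) (auto split: letter.splits)

lemma Ra_preimage: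
  assumes "\<not> sublist [B, B] x" "x = [] \<or> last x = A"
  shows "\<exists>z. x = Ra z"
proof -
  have "\<not> sublist [B, B] (rev x)"
    using assms(1) sublist_rev[of "[B, B]" "rev x"] by simp
  then obtain z where "rev x = La z"
    using La_preimage[of "rev x"] assms(2) by (auto simp: hd_rev)
  then have "x = Ra (rev z)" by (metis rev_La rev_rev_ident)
  then show ?thesis ..
qed

lemma count_La_B [simp]: "count_list (La u) B = count_list u B"
  by (induction u) (auto split: letter.splits)

lemma count_Ra_B [simp]: "count_list (Ra u) B = count_list u B"
  by (induction u) (auto split: letter.splits)

section \<open>Alternating words\<close>

fun alternating :: "letter \<Rightarrow> nat \<Rightarrow> letter list" where
  "alternating c 0 = []"
| "alternating c (Suc n) = c # alternating (flip c) n"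

lemma length_alternating [simp]: "length (alternating c n) = n"
  by (induction n arbitrary: c) auto

lemma alternating_add:
  "alternating c (m + n) = alternating c m @ alternating (if even m then c else flip c) n"
  by (induction m arbitrary: c) auto

lemma count_alternating:
  "count_list (alternating A n) A = Suc n div 2" "count_list (alternating B n) A = n div 2"
  by (induction n) auto

lemma alternatingI:
  assumes "\<not> sublist [A, A] x" "\<not> sublist [B, B] x" "x = [] \<or> hd x = c"
  shows "x = alternating c (length x)"
  using assms
proof (induction x arbitrary: c)
  case (Cons d t)
  have "\<not> sublist [A, A] t" "\<not> sublist [B, B] t" "t = [] \<or> hd t = flip c"
    using Cons.prems by (cases t; cases c; auto simp: sublist_Cons_right)+
  then show ?case using Cons by auto
qed auto

section \<open>Prefix and suffix comparability\<close>

definition comparable :: "'a list \<Rightarrow> 'a list \<Rightarrow> bool" where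
  "comparable x y \<longleftrightarrow> prefix x y \<or> prefix y x \<or> suffix x y \<or> suffix y x"

lemma comparable_E [simp]: "comparable (E x) (E y) \<longleftrightarrow> comparable x y"
  unfolding comparable_def by simp

lemma comparable_image2: "comparable x y \<Longrightarrow> comparable (image2 p q x) (image2 p q y)"
  unfolding comparable_def prefix_def suffix_def by (elim disjE exE) auto

lemma comparable_alternating_same: "comparable (alternating c m) (alternating c n)"
proof (cases "m \<le> n")
  case True
  then show ?thesis
    using alternating_add[of c m "n - m"] by (simp add: comparable_def)
next
  case False
  then show ?thesis
    using alternating_add[of c n "m - n"] by (simp add: comparable_def)
qed

text \<open>For odd \<open>m + n\<close> the two words, when nonempty, have the same last letter, so
  the shorter is a suffix of the longer.\<close>

lemma comparable_alternating_parity: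
  assumes "odd (m + n)"
  shows "comparable (alternating A m) (alternating B n)"
proof (cases "m \<le> n")
  case True
  then have "alternating B n = alternating B (n - m) @ alternating A m"
    using alternating_add[of B "n - m" m] assms by simp
  then show ?thesis unfolding comparable_def by (metis suffixI)
next
  case False
  then have "alternating A m = alternating A (m - n) @ alternating B n"
    using alternating_add[of A "m - n" n] assms by simp
  then show ?thesis unfolding comparable_def by (metis suffixI)
qed

section \<open>Bi-infinite mechanical words\<close>

text \<open>For \<open>\<alpha>\<close> between 0 and 1 this is the mechanical word of slope
  \<open>\<alpha>\<close> and intercept 0, with \<open>B\<close> at the jumps of the floor. Integer
  indices give every factor a left neighbour too.\<close>

definition mech :: "real \<Rightarrow> int \<Rightarrow> letter" where
  "mech \<alpha> i = (if \<lfloor>of_int (i + 1) * \<alpha>\<rfloor> = \<lfloor>of_int i * \<alpha>\<rfloor> then A else B)"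

definition mech_block :: "real \<Rightarrow> int \<Rightarrow> nat \<Rightarrow> letter list" where
  "mech_block \<alpha> i n = map (\<lambda>k. mech \<alpha> (i + int k)) [0..<n]"

definition mech_language :: "real \<Rightarrow> letter list set" where
  "mech_language \<alpha> = {mech_block \<alpha> i n |i n. True}"

definition mech_stream :: "real \<Rightarrow> int \<Rightarrow> letter stream" where
  "mech_stream \<alpha> i = smap (\<lambda>n. mech \<alpha> (i + int n)) nats"

lemma length_mech_block [simp]: "length (mech_block \<alpha> i n) = n"
  by (simp add: mech_block_def)

lemma snth_mech_stream [simp]: "mech_stream \<alpha> i !! n = mech \<alpha> (i + int n)"
  by (simp add: mech_stream_def)

lemma is_factor_mech_streamE:
  assumes "is_factor u (mech_stream \<alpha> i)"
  obtains j where "u = mech_block \<alpha> j (length u)"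
proof -
  obtain p s where w: "mech_stream \<alpha> i = p @- u @- s"
    using assms unfolding is_factor_def by blast
  have "u ! k = mech \<alpha> (i + int (length p) + int k)" if "k < length u" for k
    using arg_cong[OF w, of "\<lambda>w. w !! (length p + k)"] that by (simp add: algebra_simps)
  then have "u = mech_block \<alpha> (i + int (length p)) (length u)"
    by (auto intro!: nth_equalityI simp: mech_block_def)
  then show ?thesis by (rule that)
qed

lemma mech_stream_decomp:
  "mech_stream \<alpha> i = mech_block \<alpha> i m @- mech_block \<alpha> (i + int m) n @- mech_stream \<alpha> (i + int m + int n)"
proof -
  have "mech_stream \<alpha> i !! k =
      (mech_block \<alpha> i m @- mech_block \<alpha> (i + int m) n @- mech_stream \<alpha> (i + int m + int n)) !! k" for k
    by (simp add: shift_snth mech_block_def)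
  then show ?thesis by (metis smap_alt stream.map_id)
qed

lemma mech_block_snoc: "mech_block \<alpha> i (Suc n) = mech_block \<alpha> i n @ [mech \<alpha> (i + int n)]"
  by (simp add: mech_block_def)

lemma mech_block_Cons: "mech_block \<alpha> i (Suc n) = mech \<alpha> i # mech_block \<alpha> (i + 1) n"
  by (auto intro!: nth_equalityI simp: mech_block_def nth_Cons' algebra_simps simp del: upt_Suc)

context
  fixes \<alpha> :: real
  assumes \<alpha>: "0 < \<alpha>" "\<alpha> < 1"
begin

lemma floor_mech:
  "\<lfloor>of_int (i + 1) * \<alpha>\<rfloor> = \<lfloor>of_int i * \<alpha>\<rfloor> + (if mech \<alpha> i = A then 0 else 1)"
proof -
  have "of_int (i + 1) * \<alpha> = of_int i * \<alpha> + \<alpha>" by (simp add: algebra_simps)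
  then have "\<lfloor>of_int (i + 1) * \<alpha>\<rfloor> = \<lfloor>of_int i * \<alpha>\<rfloor> \<or> \<lfloor>of_int (i + 1) * \<alpha>\<rfloor> = \<lfloor>of_int i * \<alpha>\<rfloor> + 1"
    using \<alpha> by linarith
  then show ?thesis by (auto simp: mech_def)
qed

text \<open>The jumps telescope: the difference of the two floors is the number of \<open>B\<close>
  in the block.\<close>

lemma count_mech_block:
  "int (count_list (mech_block \<alpha> i n) A) =
     int n - (\<lfloor>of_int (i + int n) * \<alpha>\<rfloor> - \<lfloor>of_int i * \<alpha>\<rfloor>)"
proof (induction n)
  case 0
  then show ?case by (simp add: mech_block_def)
next
  case (Suc n)
  then show ?case
    using floor_mech[of "i + int n"] by (auto simp: mech_block_snoc algebra_simps)
qed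

text \<open>Over any window of length \<open>n\<close> the floor grows by the floor of
  \<open>n * \<alpha>\<close> or by one more.\<close>

lemma balanced_mech_stream: "balanced (mech_stream \<alpha> i)"
  unfolding balanced_def
proof (intro allI impI)
  fix u v assume "is_factor u (mech_stream \<alpha> i)" "is_factor v (mech_stream \<alpha> i)"
    and len: "length u = length v"
  then obtain j k where u: "u = mech_block \<alpha> j (length u)" and v: "v = mech_block \<alpha> k (length u)"
    by (metis is_factor_mech_streamE)
  define n where "n = length u"
  have "of_int (j + int n) * \<alpha> = of_int j * \<alpha> + real n * \<alpha>"
    "of_int (k + int n) * \<alpha> = of_int k * \<alpha> + real n * \<alpha>"
    by (simp_all add: algebra_simps)
  then have "\<bar>(\<lfloor>of_int (j + int n) * \<alpha>\<rfloor> - \<lfloor>of_int j * \<alpha>\<rfloor>) -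
      (\<lfloor>of_int (k + int n) * \<alpha>\<rfloor> - \<lfloor>of_int k * \<alpha>\<rfloor>)\<bar> \<le> 1"
    by linarith
  then show "\<bar>int (count_list u A) - int (count_list v A)\<bar> \<le> 1"
    using count_mech_block[of j n] count_mech_block[of k n] u v unfolding n_def by simp
qed

text \<open>Along a period \<open>p\<close> containing \<open>q\<close> letters \<open>B\<close> the
  floor grows linearly, so \<open>k * \<bar>p * \<alpha> - q\<bar>\<close> stays bounded for all
  \<open>k\<close>. This forces \<open>\<alpha> = q / p\<close>.\<close>

lemma not_ultimately_periodic_mech_stream:
  assumes irrat: "\<alpha> \<notin> \<rat>"
  shows "\<not> ultimately_periodic (mech_stream \<alpha> i)"
proof
  assume "ultimately_periodic (mech_stream \<alpha> i)"
  then obtain u v where v: "v \<noteq> []" and w: "mech_stream \<alpha> i = u @- cycle v"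
    unfolding ultimately_periodic_def by blast
  define p where "p = length v"
  define j where "j = i + int (length u)"
  have "p > 0" using v by (simp add: p_def)
  have per: "mech \<alpha> (j + int (n + p)) = mech \<alpha> (j + int n)" for n
  proof -
    have "cycle v !! (n + p) = cycle v !! n"
      using v unfolding p_def by (subst (1) cycle_decomp) auto
    then show ?thesis
      using arg_cong[OF w, of "\<lambda>w. w !! (length u + (n + p))"]
        arg_cong[OF w, of "\<lambda>w. w !! (length u + n)"]
      by (simp add: j_def add.assoc)
  qed
  have "mech_block \<alpha> (j + int (k * p)) p = mech_block \<alpha> j p" for k
  proof (induction k)
    case (Suc k)
    have "mech_block \<alpha> (j + int (Suc k * p)) p = mech_block \<alpha> (j + int (k * p)) p"
      using per[of "k * p + n" for n]
      by (auto intro!: nth_equalityI simp: mech_block_def algebra_simps)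
    with Suc show ?case by simp
  qed simp
  then have step: "\<lfloor>of_int (j + int (k * p) + int p) * \<alpha>\<rfloor> - \<lfloor>of_int (j + int (k * p)) * \<alpha>\<rfloor> =
      \<lfloor>of_int (j + int p) * \<alpha>\<rfloor> - \<lfloor>of_int j * \<alpha>\<rfloor>" for k
    using count_mech_block[of "j + int (k * p)" p] count_mech_block[of j p] by simp
  define q where "q = \<lfloor>of_int (j + int p) * \<alpha>\<rfloor> - \<lfloor>of_int j * \<alpha>\<rfloor>"
  have lin: "\<lfloor>of_int (j + int (k * p)) * \<alpha>\<rfloor> = \<lfloor>of_int j * \<alpha>\<rfloor> + int k * q" for k
  proof (induction k)
    case (Suc k)
    have "j + int (Suc k * p) = j + int (k * p) + int p" by (simp add: algebra_simps)
    then show ?case using step[of k] Suc unfolding q_def by (simp add: algebra_simps)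
  qed simp
  have "real k * \<bar>real p * \<alpha> - of_int q\<bar> \<le> 1" for k
  proof -
    have "of_int (j + int (k * p)) * \<alpha> = of_int j * \<alpha> + real k * (real p * \<alpha>)"
      by (simp add: algebra_simps)
    moreover have "real_of_int (int k * q) = real k * of_int q" by simp
    ultimately have "\<bar>real k * (real p * \<alpha>) - real k * of_int q\<bar> \<le> 1"
      using lin[of k] by linarith
    then show ?thesis by (simp add: abs_mult flip: right_diff_distrib)
  qed
  then have "\<bar>real p * \<alpha> - of_int q\<bar> = 0"
    by (metis abs_ge_zero less_eq_real_def linorder_not_less reals_Archimedean3)
  then have "\<alpha> = of_int q / real p"
    using \<open>p > 0\<close> by (simp add: field_simps)
  then show False using irrat by simp
qed

lemma sturmian_mech_stream: "\<alpha> \<notin> \<rat> \<Longrightarrow> sturmian (mech_stream \<alpha> i)"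
  by (simp add: sturmian_def balanced_mech_stream not_ultimately_periodic_mech_stream)

end

section \<open>Explicit factors for two slopes\<close>

lemma mech_eq_A: "of_int m \<le> of_int i * \<alpha> \<Longrightarrow> of_int i * \<alpha> < of_int m + 1 \<Longrightarrow>
   of_int m \<le> (of_int i + 1) * \<alpha> \<Longrightarrow> (of_int i + 1) * \<alpha> < of_int m + 1 \<Longrightarrow> mech \<alpha> i = A"
  unfolding mech_def by (simp add: floor_unique[of m])

lemma mech_eq_B: "of_int i * \<alpha> < of_int m \<Longrightarrow> of_int m \<le> (of_int i + 1) * \<alpha> \<Longrightarrow> mech \<alpha> i = B"
  unfolding mech_def using floor_less_iff[of "of_int i * \<alpha>" m] le_floor_iff[of m "(of_int i + 1) * \<alpha>"] by simp

text \<open>Three steps of length \<open>\<alpha>\<close> stay below 1 and four exceed it, so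
  exactly three \<open>A\<close> follow the \<open>B\<close> at position -1. The second block is the
  mirror image with letters exchanged: \<open>mech (1 - \<alpha>) (-1 - i)\<close> is the flip of
  \<open>mech \<alpha> i\<close>, hence the start at -4.\<close>

lemma mech_language_witness:
  assumes "1/4 < \<alpha>" "\<alpha> < 1/3"
  shows "[B, A, A, A, B] \<in> mech_language \<alpha>" "[A, B, B, B, A] \<in> mech_language (1 - \<alpha>)"
proof -
  have "mech \<alpha> (-1) = B" by (rule mech_eq_B[of _ _ 0]) (use assms in auto)
  moreover have "mech \<alpha> 0 = A" "mech \<alpha> 1 = A" "mech \<alpha> 2 = A"
    by (rule mech_eq_A[of 0]; use assms in simp)+
  moreover have "mech \<alpha> 3 = B" by (rule mech_eq_B[of _ _ 1]) (use assms in auto)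
  ultimately have "mech_block \<alpha> (-1) 5 = [B, A, A, A, B]"
    by (simp add: mech_block_def upt_rec)
  then show "[B, A, A, A, B] \<in> mech_language \<alpha>"
    unfolding mech_language_def by (metis (mono_tags, lifting) mem_Collect_eq)
  have "mech (1 - \<alpha>) (-4) = A" by (rule mech_eq_A[of "-3"]) (use assms in auto)
  moreover have "mech (1 - \<alpha>) (-3) = B" by (rule mech_eq_B[of _ _ "-2"]) (use assms in auto)
  moreover have "mech (1 - \<alpha>) (-2) = B" by (rule mech_eq_B[of _ _ "-1"]) (use assms in auto)
  moreover have "mech (1 - \<alpha>) (-1) = B" by (rule mech_eq_B[of _ _ "0"]) (use assms in auto)
  moreover have "mech (1 - \<alpha>) 0 = A" by (rule mech_eq_A[of 0]) (use assms in auto)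
  ultimately have "mech_block (1 - \<alpha>) (-4) 5 = [A, B, B, B, A]"
    by (simp add: mech_block_def upt_rec)
  then show "[A, B, B, B, A] \<in> mech_language (1 - \<alpha>)"
    unfolding mech_language_def by (metis (mono_tags, lifting) mem_Collect_eq)
qed

lemma extendable_mech_language: "extendable (mech_language \<alpha>)"
  unfolding extendable_def
proof
  fix u assume "u \<in> mech_language \<alpha>"
  then obtain i n where "u = mech_block \<alpha> i n" unfolding mech_language_def by blast
  moreover have "mech \<alpha> (i - 1) # mech_block \<alpha> i n = mech_block \<alpha> (i - 1) (Suc n)"
    by (simp only: mech_block_Cons) simp
  ultimately have "u @ [mech \<alpha> (i + int n)] = mech_block \<alpha> i (Suc n)"
    "mech \<alpha> (i - 1) # u = mech_block \<alpha> (i - 1) (Suc n)"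
    by (simp_all add: mech_block_snoc)
  then show "(\<exists>c. u @ [c] \<in> mech_language \<alpha>) \<and> (\<exists>c. c # u \<in> mech_language \<alpha>)"
    unfolding mech_language_def by blast
qed

section \<open>Balance of the images of mechanical languages\<close>

lemma is_factor_image:
  assumes f: "morphism f" and "maps_to f w v" and "w = p @- s @- t" and "sublist u (f s)"
  shows "is_factor u v"
proof -
  have "stake (length (p @ s)) w = p @ s"
    using assms(3) by (simp add: stake_shift)
  then have "is_prefix (f p @ f s) v"
    using assms(2) f unfolding maps_to_def morphism_def by metis
  then show ?thesis
    using assms(4) unfolding is_prefix_def is_factor_def sublist_def
    by (metis append.assoc shift_append)
qed

text \<open>Blocks starting at \<open>i\<close> and \<open>j\<close> both occur in the
  right-infinite word read from \<open>min i j\<close>. That word is Sturmian, so the balance of its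
  image compares the images of the two blocks.\<close>

lemma balanced_set_mech_image:
  assumes f: "sturmian_morphism f" and \<alpha>: "0 < \<alpha>" "\<alpha> < 1" "\<alpha> \<notin> \<rat>"
  shows "balanced_set (f ` mech_language \<alpha>)"
proof -
  have "count_list u A \<le> Suc (count_list v A)"
    if "sublist u (f (mech_block \<alpha> i m))" "sublist v (f (mech_block \<alpha> j n))" "length u = length v"
    for u v i j m n
  proof -
    define k where "k = min i j"
    obtain w where w: "maps_to f (mech_stream \<alpha> k) w" "balanced w"
      using f sturmian_mech_stream[OF \<alpha>] unfolding sturmian_morphism_def sturmian_def by blast
    have mor: "morphism f" using f unfolding sturmian_morphism_def by blast
    have i: "i = k + int (nat (i - k))" and j: "j = k + int (nat (j - k))"
      unfolding k_def by simp_all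
    have "is_factor u w"
      using is_factor_image[OF mor w(1) mech_stream_decomp[of \<alpha> k "nat (i - k)" m]] that(1) i by simp
    moreover have "is_factor v w"
      using is_factor_image[OF mor w(1) mech_stream_decomp[of \<alpha> k "nat (j - k)" n]] that(2) j by simp
    ultimately have "\<bar>int (count_list u A) - int (count_list v A)\<bar> \<le> 1"
      using w(2) that(3) unfolding balanced_def by blast
    then show ?thesis by linarith
  qed
  then show ?thesis
    unfolding balanced_set_def mech_language_def by blast
qed

section \<open>Comparability of the two images\<close>

text \<open>Without squares both words alternate. Equal first letters give a prefix, an odd total
  length gives a suffix. If both lengths are even, the seams of \<open>yx\<close> and
  \<open>xy\<close> produce \<open>AA\<close> and \<open>BB\<close>. If both are odd and one exceeds
  1, a factor of \<open>xxx\<close> or \<open>yyy\<close> is too rich or too poor in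
  \<open>A\<close>.\<close>

lemma comparable_if_no_squares:
  assumes bal: "balanced_set (image2 x y ` F)" "balanced_set (image2 x y ` G)"
    and F: "[B, A, A, A, B] \<in> F" and G: "[A, B, B, B, A] \<in> G"
    and sq: "\<not> sublist [A, A] x" "\<not> sublist [B, B] x" "\<not> sublist [A, A] y" "\<not> sublist [B, B] y"
    and ne: "x \<noteq> []" "y \<noteq> []" and "hd x = A"
  shows "comparable x y \<or> x = [A] \<and> y = [B]"
proof (cases "hd y")
  case A
  then show ?thesis
    using alternatingI[OF sq(1,2), of A] alternatingI[OF sq(3,4), of A] \<open>hd x = A\<close>
      comparable_alternating_same by metis
next
  case B
  define m n where "m = length x" and "n = length y"
  have x: "x = alternating A m" and y: "y = alternating B n"
    using alternatingI[OF sq(1,2), of A] alternatingI[OF sq(3,4), of B] B \<open>hd x = A\<close>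
    by (simp_all add: m_def n_def)
  have pos: "m > 0" "n > 0" using ne by (simp_all add: m_def n_def)
  define S where "S = y @ x @ x @ x @ y"
  define T where "T = x @ y @ y @ y @ x"
  have S: "S \<in> image2 x y ` F" and T: "T \<in> image2 x y ` G"
    using imageI[OF F, of "image2 x y"] imageI[OF G, of "image2 x y"] by (simp_all add: S_def T_def)
  consider "odd (m + n)" | "even m" "even n" | "odd m" "odd n" "m = 1" "n = 1"
    | "odd m" "odd n" "m \<ge> 3" | "odd m" "odd n" "n \<ge> 3"
    using pos by (metis One_nat_def Suc_leI even_add even_numeral le_antisym not_less_eq_eq
        numeral_3_eq_3 odd_one numeral_2_eq_2)
  then show ?thesis
  proof cases
    case 1
    then show ?thesis using comparable_alternating_parity x y by simp
  next
    case 2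
    have x1: "x = A # alternating B (m - 1)" and y1: "y = B # alternating A (n - 1)"
      using pos x y by (cases m; cases n; simp)+
    have x2: "x = alternating A (m - 1) @ [B]" and y2: "y = alternating B (n - 1) @ [A]"
      using alternating_add[of A "m - 1" 1] alternating_add[of B "n - 1" 1] pos 2 x y by simp_all
    have "sublist [A, A] (y @ x)"
      by (subst x1, subst y2) (auto simp: sublist_append)
    then have "sublist [A, A] S"
      unfolding S_def by (metis append.assoc sublist_append_rightI sublist_order.order.trans)
    moreover have "sublist [B, B] (x @ y)"
      by (subst x2, subst y1) (auto simp: sublist_append)
    then have "sublist [B, B] S"
      unfolding S_def by (metis append.assoc sublist_append_leftI sublist_order.order.trans)
    ultimately show ?thesis using balanced_set_squares[OF bal(1) S] by blast
  next
    case 3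
    then show ?thesis using x y by simp
  next
    case 4
    \<comment> \<open>Both words have length \<open>n + 2\<close>. The alternating \<open>xy\<close>
      has \<open>?u\<close> as a prefix because \<open>m \<ge> 3\<close>; \<open>?v\<close>
      surrounds the middle \<open>y\<close> of the cube \<open>yyy\<close> and has two fewer
      \<open>A\<close>.\<close>
    let ?u = "alternating A (n + 2)" and ?v = "[B] @ y @ [B]"
    have "(n + 2) + (m - 2) = m + n" using 4 by simp
    then have "x @ y = alternating A ((n + 2) + (m - 2))"
      using alternating_add[of A m n] 4 x y by (metis letter.case(1))
    then have "sublist ?u (x @ y)"
      by (simp only: alternating_add[of A "n + 2"] sublist_append_rightI)
    then have "sublist ?u T"
      unfolding T_def by (metis append.assoc sublist_append_rightI sublist_order.order.trans)
    moreover have "y = alternating B (n - 1) @ [B]" "y = B # alternating A (n - 1)"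
      using alternating_add[of B "n - 1" 1] pos 4 y by (cases n; simp)+
    then have "T = (x @ alternating B (n - 1)) @ ?v @ (alternating A (n - 1) @ x)"
      unfolding T_def by (metis append.assoc append_Cons append_Nil)
    then have "sublist ?v T" by (metis sublist_appendI)
    ultimately have "count_list ?u A \<le> Suc (count_list ?v A)"
      using balanced_setD[OF bal(2) T T, of ?u ?v] by (simp add: n_def)
    then show ?thesis using 4 y count_alternating[of n] count_alternating(1)[of "n + 2"] by simp
  next
    case 5
    \<comment> \<open>The same comparison with the letters exchanged: \<open>?u\<close> surrounds
      the middle \<open>x\<close> of \<open>xxx\<close> and has two more \<open>A\<close> than the
      prefix \<open>?v\<close> of \<open>yx\<close>.\<close>
    let ?v = "alternating B (m + 2)" and ?u = "[A] @ x @ [A]"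
    have "(m + 2) + (n - 2) = n + m" using 5 by simp
    then have "y @ x = alternating B ((m + 2) + (n - 2))"
      using alternating_add[of B n m] 5 x y by (metis letter.case(2))
    then have "sublist ?v (y @ x)"
      by (simp only: alternating_add[of B "m + 2"] sublist_append_rightI)
    then have "sublist ?v S"
      unfolding S_def by (metis append.assoc sublist_append_rightI sublist_order.order.trans)
    moreover have "x = alternating A (m - 1) @ [A]" "x = A # alternating B (m - 1)"
      using alternating_add[of A "m - 1" 1] pos 5 x by (cases m; simp)+
    then have "S = (y @ alternating A (m - 1)) @ ?u @ (alternating B (m - 1) @ y)"
      unfolding S_def by (metis append.assoc append_Cons append_Nil)
    then have "sublist ?u S" by (metis sublist_appendI)
    ultimately have "count_list ?u A \<le> Suc (count_list ?v A)"
      using balanced_setD[OF bal(1) S S, of ?u ?v] by (simp add: m_def)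
    then show ?thesis using 5 x count_alternating[of m] count_alternating(2)[of "m + 2"] by simp
  qed
qed

text \<open>Unless \<open>B\<close> is absent, \<open>x\<close> and \<open>y\<close> factor jointly
  through \<open>La\<close> or \<open>Ra\<close>, and the shorter words inherit the balance. The
  induction hypothesis is an explicit assumption so that the argument can also be applied to
  \<open>E x\<close> and \<open>E y\<close>.\<close>

lemma comparable_desubstitute:
  assumes F: "extendable F" "[B, A, A, A, B] \<in> F" and G: "extendable G" "[A, B, B, B, A] \<in> G"
    and bal: "balanced_set (image2 x y ` F)" "balanced_set (image2 x y ` G)"
    and noBB: "\<not> sublist [B, B] (image2 x y [B, A, A, A, B])"
      "\<not> sublist [B, B] (image2 x y [A, B, B, B, A])"
    and ne: "x \<noteq> []" "y \<noteq> []"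
    and IH: "\<And>x' y'. length x' + length y' < length x + length y \<Longrightarrow>
      balanced_set (image2 x' y' ` F) \<Longrightarrow> balanced_set (image2 x' y' ` G) \<Longrightarrow>
      comparable x' y' \<or> x' = [A] \<and> y' = [B] \<or> x' = [B] \<and> y' = [A]"
  shows "comparable x y"
proof -
  have pairs: "\<not> sublist [B, B] (x @ x)" "\<not> sublist [B, B] (y @ y)"
    "\<not> sublist [B, B] (x @ y)" "\<not> sublist [B, B] (y @ x)"
    using noBB by (simp, metis append.assoc append_Nil2 sublist_append_leftI sublist_append_rightI
        sublist_order.order.trans)+
  then have noBB': "\<not> sublist [B, B] x" "\<not> sublist [B, B] y"
    by (auto simp: sublist_append)
  have junction: "last u \<noteq> B \<or> hd v \<noteq> B" if "\<not> sublist [B, B] (u @ v)" "u \<noteq> []" "v \<noteq> []" for u v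
  proof (rule ccontr)
    assume "\<not> (last u \<noteq> B \<or> hd v \<noteq> B)"
    then have "u @ v = butlast u @ [B, B] @ tl v"
      using that(2,3) append_butlast_last_id[of u] list.collapse[of v]
      by (metis append.assoc append_Cons append_Nil)
    then show False using that(1) by (metis sublist_appendI)
  qed
  \<comment> \<open>If one of the words starts with \<open>B\<close>, the seams force both words to
    end with \<open>A\<close>; this decides between \<open>La\<close> and \<open>Ra\<close>.\<close>
  have j: "last x = A \<or> hd x = A" "last y = A \<or> hd y = A" "last x = A \<or> hd y = A"
    "last y = A \<or> hd x = A"
    using junction[OF pairs(1)] junction[OF pairs(2)] junction[OF pairs(3)] junction[OF pairs(4)] ne
    by simp_all
  \<comment> \<open>The exceptional outcomes of the induction hypothesis cause no harm: the images
    of the single letters under the chosen morphism are comparable.\<close>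
  have desub: "comparable (image2 p q x') (image2 p q y')"
    if "balanced_set (image2 x' y' ` F)" "balanced_set (image2 x' y' ` G)"
      "length x' + length y' < length x + length y"
      "comparable (image2 p q [A]) (image2 p q [B])" for x' y' and p q :: "letter list"
    using IH[OF that(3,1,2)] comparable_image2[of x' y' p q] that(4)
    by (auto simp: comparable_def)
  show ?thesis
  proof (cases "B \<in> set x \<union> set y")
    case False
    then have "x = replicate (length x) A" "y = replicate (length y) A"
      by (metis UnCI neq_A replicate_eqI)+
    then show ?thesis
      unfolding comparable_def by (metis le_add_diff_inverse nat_le_linear prefixI replicate_add)
  next
    case True
    \<comment> \<open>Desubstitution removes one letter per \<open>B\<close>, so one occurrence
      makes the total length drop.\<close>
    then have B: "count_list x B + count_list y B > 0"
      by (metis UnE add_gr_0 count_list_0_iff gr0I)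
    show ?thesis
    proof (cases "hd x = A \<and> hd y = A")
      case True
      then obtain x' y' where xy: "x = La x'" "y = La y'"
        using La_preimage noBB' by meson
      moreover have "x' \<noteq> []" "y' \<noteq> []" using ne xy by auto
      ultimately show ?thesis
        using desub[of x' y' "[A]" "[A, B]"] balanced_set_La[of F x' y'] balanced_set_La[of G x' y']
          F G bal B by (auto simp: comparable_def)
    next
      case False
      then have "last x = A" "last y = A" using j by auto
      then obtain x' y' where xy: "x = Ra x'" "y = Ra y'"
        using Ra_preimage noBB' by meson
      moreover have "x' \<noteq> []" "y' \<noteq> []" using ne xy by auto
      moreover have "suffix [A] [B, A]" by (simp add: suffix_def)
      ultimately show ?thesis
        using desub[of x' y' "[A]" "[B, A]"] balanced_set_Ra[of F x' y'] balanced_set_Ra[of G x' y']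
          F G bal B by (auto simp: comparable_def)
    qed
  qed
qed

theorem comparable_if_balanced:
  assumes F: "extendable F" "[B, A, A, A, B] \<in> F" and G: "extendable G" "[A, B, B, B, A] \<in> G"
    and bal: "balanced_set (image2 x y ` F)" "balanced_set (image2 x y ` G)"
  shows "comparable x y \<or> x = [A] \<and> y = [B] \<or> x = [B] \<and> y = [A]"
  using bal
proof (induction "length x + length y" arbitrary: x y rule: less_induct)
  case less
  define S where "S = image2 x y [B, A, A, A, B]"
  define T where "T = image2 x y [A, B, B, B, A]"
  have S: "S \<in> image2 x y ` F" and T: "T \<in> image2 x y ` G"
    unfolding S_def T_def by (rule imageI[OF F(2)], rule imageI[OF G(2)])
  have sub: "sublist x S" "sublist y S" "sublist x T" "sublist y T"
    by (auto simp: S_def T_def sublist_append)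
  show ?case
  proof (cases "x = [] \<or> y = []")
    case True
    then show ?thesis by (auto simp: comparable_def)
  next
    case False
    \<comment> \<open>By balance, each of \<open>S\<close> and \<open>T\<close> avoids
      \<open>AA\<close> or \<open>BB\<close>. If they have no avoided square in common, then
      \<open>x\<close> and \<open>y\<close>, as factors of both, contain neither square.\<close>
    consider "\<not> sublist [B, B] S" "\<not> sublist [B, B] T" | "\<not> sublist [A, A] S" "\<not> sublist [A, A] T"
      | "\<not> sublist [A, A] x" "\<not> sublist [B, B] x" "\<not> sublist [A, A] y" "\<not> sublist [B, B] y"
      using balanced_set_squares[OF less.prems(1) S] balanced_set_squares[OF less.prems(2) T] sub
      by (meson sublist_order.order.trans)
    then show ?thesis
    proof cases
      case 1
      then show ?thesis
        using comparable_desubstitute[OF F G less.prems] less.hyps False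
        unfolding S_def T_def by blast
    next
      case 2
      have "\<not> sublist [B, B] (E S)" "\<not> sublist [B, B] (E T)"
        using 2 sublist_E_iff[of "[A, A]"] by simp_all
      then have "comparable (E x) (E y)"
        using comparable_desubstitute[OF F G less.prems[THEN balanced_set_image2_E]]
          less.hyps False unfolding S_def T_def E_image2 by fastforce
      then show ?thesis by simp
    next
      case 3
      show ?thesis
      proof (cases "hd x")
        case A
        then show ?thesis
          using comparable_if_no_squares[OF less.prems F(2) G(2) 3] False by blast
      next
        case B
        then have "hd (E x) = A" using False by (cases x) auto
        moreover have "\<not> sublist [A, A] (E u)" if "\<not> sublist [B, B] u" for u
          using that sublist_E_iff[of "[A, A]" u] by simp
        moreover have "\<not> sublist [B, B] (E u)" if "\<not> sublist [A, A] u" for u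
          using that sublist_E_iff[of "[B, B]" u] by simp
        ultimately have "comparable (E x) (E y) \<or> E x = [A] \<and> E y = [B]"
          using comparable_if_no_squares[OF less.prems[THEN balanced_set_image2_E] F(2) G(2)]
            3 False by simp
        then show ?thesis by (auto simp: E_eq_iff)
      qed
    qed
  qed
qed

section \<open>Images of eventually constant words\<close>

lemma sconst_snth: "sconst d !! n = d"
  by (induction n) auto

lemma cycle_replicate: "v \<noteq> [] \<Longrightarrow> cycle v = concat (replicate n v) @- cycle v"
  by (induction n) (auto simp flip: cycle_decomp)

lemma morphism_Nil: "morphism f \<Longrightarrow> f [] = []"
  unfolding morphism_def by (metis append_Nil append_self_conv)

lemma morphism_replicate: "morphism f \<Longrightarrow> f (replicate n d) = concat (replicate n (f [d]))"
proof (induction n)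
  case (Suc n)
  then show ?case unfolding morphism_def by (metis append_Cons append_Nil concat.simps(2) replicate_Suc)
qed (simp add: morphism_Nil)

text \<open>A prefix ending inside \<open>u\<close> is completed by \<open>f (drop n u)\<close>.
  Beyond \<open>u\<close> the image is \<open>f u\<close> followed by copies of
  \<open>f [d]\<close>, whose nonemptiness makes the lengths unbounded.\<close>

lemma maps_to_shift_sconst:
  assumes f: "morphism f" and d: "f [d] \<noteq> []"
  shows "maps_to f (u @- sconst d) (f u @- cycle (f [d]))"
  unfolding maps_to_def
proof (intro conjI allI)
  have st: "f (stake (length u + k) (u @- sconst d)) = f u @ concat (replicate k (f [d]))" for k
    using f morphism_replicate[OF f] by (simp add: stake_shift map_replicate_const morphism_def)
  fix n
  show "is_prefix (f (stake n (u @- sconst d))) (f u @- cycle (f [d]))"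
  proof (cases "n \<le> length u")
    case True
    then have "f u = f (stake n (u @- sconst d)) @ f (drop n u)"
      using f unfolding morphism_def by (metis append_take_drop_id diff_is_0_eq' append_Nil2 stake.simps(1) stake_shift)
    then show ?thesis unfolding is_prefix_def by (metis shift_append)
  next
    case False
    then obtain k where "n = length u + k" by (metis le_Suc_ex nat_le_linear)
    then show ?thesis
      using st cycle_replicate[OF d, of k] unfolding is_prefix_def by (metis shift_append)
  qed
next
  have "k \<le> length (concat (replicate k (f [d])))" for k
    using d by (induction k) (auto simp: Suc_le_eq add_strict_increasing neq_Nil_conv)
  moreover fix m
  have "f (stake (length u + m) (u @- sconst d)) = f u @ concat (replicate m (f [d]))"
    using f morphism_replicate[OF f] by (simp add: stake_shift map_replicate_const morphism_def)
  ultimately show "\<exists>n. m \<le> length (f (stake n (u @- sconst d)))"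
    by (metis length_append trans_le_add2)
qed

text \<open>Only the first two occurrences of the quasiperiod are kept; they suffice for the
  refutation that follows.\<close>

lemma quasiperiodicE:
  assumes "quasiperiodic w"
  obtains u n where "u \<noteq> []" "0 < n" "n \<le> length u" "is_prefix u w"
    "\<forall>i<length u. w !! (n + i) = u ! i"
proof -
  obtain u p where p0: "p 0 = []"
    and p: "0 < int (length (p (Suc 0))) - int (length (p 0))"
      "int (length (p (Suc 0))) - int (length (p 0)) \<le> int (length u)"
    and "is_prefix (p 0 @ u) w" "is_prefix (p (Suc 0) @ u) w"
    using assms unfolding quasiperiodic_def by metis
  moreover from this(5) have "w !! (length (p (Suc 0)) + i) = u ! i" if "i < length u" for i
    using that unfolding is_prefix_def by auto
  ultimately show ?thesis
    by (intro that[of u "length (p (Suc 0))"]) auto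
qed

text \<open>If the first occurrence of \<open>u\<close> contained position \<open>k\<close>, the
  second would repeat \<open>c\<close> at \<open>n + k\<close>. So \<open>u\<close> is a single
  letter and \<open>k = 1\<close>, and the second occurrence, at position 1, makes the first two
  letters of \<open>w\<close> equal, although only one of them is \<open>c\<close>.\<close>

lemma not_quasiperiodic_if_unique_letter:
  assumes "\<And>n. w !! n = c \<longleftrightarrow> n = k" and "k \<le> 1"
  shows "\<not> quasiperiodic w"
proof
  assume "quasiperiodic w"
  then obtain u n where u: "u \<noteq> []" "0 < n" "n \<le> length u" "is_prefix u w"
    "\<forall>i<length u. w !! (n + i) = u ! i"
    by (rule quasiperiodicE)
  have pre: "w !! i = u ! i" if "i < length u" for i
    using u(4) that unfolding is_prefix_def by auto
  have "k \<ge> length u"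
  proof (rule ccontr)
    assume "\<not> length u \<le> k"
    then have "w !! (n + k) = c" using u(5)[rule_format, of k] pre[of k] assms(1)[of k] by simp
    then show False using assms(1)[of "n + k"] u(2) by simp
  qed
  then have "length u = 1" "k = 1" "n = 1"
    using u assms(2) by (simp_all add: Suc_le_eq flip: length_greater_0_conv)
  then have "w !! 1 = w !! 0" using u(5)[rule_format, of 0] pre[of 0] by simp
  then show False using assms(1)[of 1] assms(1)[of 0] \<open>k = 1\<close> by simp
qed

section \<open>Coverings of the two kinds of images\<close>

lemma concat_replicate_append: "x @ concat (replicate n (z @ x)) = concat (replicate n (x @ z)) @ x"
  by (induction n) auto

lemma quasiperiodic_prefix:
  assumes "x @ z \<noteq> []"
  shows "quasiperiodic ((x @ z) @- x @- cycle (x @ z))"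
proof -
  \<comment> \<open>The second occurrence of \<open>xzx\<close> starts exactly where the first ends,
    which bridges the irregular \<open>x\<close>; from then on the shifts have length
    \<open>|xz|\<close>.\<close>
  define p where "p n = (case n of 0 \<Rightarrow> [] | Suc k \<Rightarrow> x @ z @ x @ concat (replicate k (x @ z)))" for n
  have cyc: "cycle (x @ z) = concat (replicate n (x @ z)) @- x @- z @- x @- z @- cycle (x @ z)" for n
    by (metis assms cycle_decomp cycle_replicate shift_append)
  have "is_prefix (p n @ x @ z @ x) ((x @ z) @- x @- cycle (x @ z))" for n
  proof (cases n)
    case 0
    then show ?thesis unfolding is_prefix_def p_def by auto
  next
    case (Suc k)
    then show ?thesis
      unfolding is_prefix_def p_def by (subst cyc[of k]) auto
  qed
  moreover have "0 < int (length (p (Suc n))) - int (length (p n)) \<and>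
      int (length (p (Suc n))) - int (length (p n)) \<le> int (length (x @ z @ x))" for n
  proof -
    have "0 < int (length x) + int (length z)" using assms by (cases x; cases z) simp_all
    then show ?thesis by (cases n) (simp_all add: p_def)
  qed
  ultimately show ?thesis
    unfolding quasiperiodic_def by (intro exI[of _ "x @ z @ x"] exI[of _ p]) (auto simp: p_def)
qed

text \<open>The word equals \<open>(xz)^\<omega>\<close>, so consecutive copies of \<open>xz\<close>
  cover it.\<close>

lemma quasiperiodic_suffix:
  assumes "z @ x \<noteq> []"
  shows "quasiperiodic (x @- cycle (z @ x))"
  unfolding quasiperiodic_def
proof (rule exI[of _ "x @ z"], rule exI[of _ "\<lambda>n. concat (replicate n (x @ z))"],
    intro conjI allI)
  fix n
  have "x @- cycle (z @ x) = (x @ concat (replicate n (z @ x))) @- z @- x @- cycle (z @ x)"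
    by (metis assms cycle_decomp cycle_replicate shift_append)
  then show "is_prefix (concat (replicate n (x @ z)) @ x @ z) (x @- cycle (z @ x))"
    unfolding is_prefix_def by (auto simp: concat_replicate_append)
next
  have "0 < int (length x) + int (length z)" using assms by (cases x; cases z) simp_all
  then show "0 < int (length (concat (replicate (Suc n) (x @ z)))) - int (length (concat (replicate n (x @ z))))"
    "int (length (concat (replicate (Suc n) (x @ z)))) - int (length (concat (replicate n (x @ z))))
      \<le> int (length (x @ z))" for n
    by simp_all
qed simp

text \<open>The witness is \<open>d c d^\<omega>\<close>, where the letter with the shorter or equal
  image occurs just once, at position 1.\<close>

lemma quasiperiodic_morphism_if_prefix:
  assumes f: "morphism f" and "f [d] \<noteq> []" "c \<noteq> d" and "prefix (f [c]) (f [d])"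
  shows "quasiperiodic_morphism f"
proof -
  obtain z where z: "f [d] = f [c] @ z" using assms(4) by (rule prefixE)
  have "([d, c] @- sconst d) !! n = c \<longleftrightarrow> n = 1" for n
    using assms(3) by (auto simp: shift_snth nth_Cons' sconst_snth simp del: shift.simps snth_siterate)
  then have "\<not> quasiperiodic ([d, c] @- sconst d)"
    by (rule not_quasiperiodic_if_unique_letter) simp
  moreover have "f [d, c] = f [d] @ f [c]"
    using f unfolding morphism_def by (metis append_Cons append_Nil)
  then have "quasiperiodic (f [d, c] @- cycle (f [d]))"
    using quasiperiodic_prefix[of "f [c]" z] assms(2) z by simp
  ultimately show ?thesis
    unfolding quasiperiodic_morphism_def using maps_to_shift_sconst[OF assms(1,2)] by blast
qed

lemma quasiperiodic_morphism_if_suffix: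
  assumes f: "morphism f" and "f [d] \<noteq> []" "c \<noteq> d" and "suffix (f [c]) (f [d])"
  shows "quasiperiodic_morphism f"
proof -
  obtain z where z: "f [d] = z @ f [c]" using assms(4) by (rule suffixE)
  have "([c] @- sconst d) !! n = c \<longleftrightarrow> n = 0" for n
    using assms(3) by (auto simp: shift_snth sconst_snth simp del: shift.simps snth_siterate)
  then have "\<not> quasiperiodic ([c] @- sconst d)"
    by (rule not_quasiperiodic_if_unique_letter) simp
  moreover have "quasiperiodic (f [c] @- cycle (f [d]))"
    using quasiperiodic_suffix[of z "f [c]"] assms(2) z by simp
  ultimately show ?thesis
    unfolding quasiperiodic_morphism_def using maps_to_shift_sconst[OF assms(1,2)] by blast
qed

section \<open>The main theorem\<close>

lemma morphism_eq_image2: "morphism f \<Longrightarrow> f = image2 (f [A]) (f [B])"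
proof
  fix u assume f: "morphism f"
  show "f u = image2 (f [A]) (f [B]) u"
  proof (induction u)
    case (Cons c u)
    have "f (c # u) = f [c] @ f u" using f unfolding morphism_def by (metis append_Cons append_Nil)
    with Cons show ?case by (cases c) simp_all
  qed (simp add: morphism_Nil[OF f])
qed

lemma image2_AB: "image2 [A] [B] = id"
proof
  show "image2 [A] [B] u = id u" for u by (induction u) (auto split: letter.splits)
qed

lemma image2_BA: "image2 [B] [A] = E"
proof
  show "image2 [B] [A] u = E u" for u by (induction u) (auto split: letter.splits)
qed

theorem mainTheorem4:
  fixes f :: "letter list \<Rightarrow> letter list"
  assumes "sturmian_morphism f" and "f \<noteq> E" and "f \<noteq> id"
  shows "quasiperiodic_morphism f"
proof -
  have f: "morphism f" using assms(1) unfolding sturmian_morphism_def by blast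
  \<comment> \<open>Countability of the rationals yields an irrational slope in the interval that
    produces the two five-letter factors.\<close>
  have "uncountable {1/4<..<1/3::real}" by (simp add: uncountable_open_interval)
  then obtain \<alpha> :: real where \<alpha>: "1/4 < \<alpha>" "\<alpha> < 1/3" "\<alpha> \<notin> \<rat>"
    by (metis countable_rat countable_subset greaterThanLessThan_iff subsetI)
  have irrat: "1 - \<alpha> \<notin> \<rat>"
    using \<alpha>(3) Rats_diff[of 1 "1 - \<alpha>"] by auto
  have bal: "balanced_set (f ` mech_language \<alpha>)" "balanced_set (f ` mech_language (1 - \<alpha>))"
    using balanced_set_mech_image[OF assms(1)] \<alpha> irrat by simp_all
  have f_eq: "f = image2 (f [A]) (f [B])" using f by (rule morphism_eq_image2)
  have "comparable (f [A]) (f [B]) \<or> f [A] = [A] \<and> f [B] = [B] \<or> f [A] = [B] \<and> f [B] = [A]"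
    using comparable_if_balanced[OF extendable_mech_language mech_language_witness(1)[OF \<alpha>(1,2)]
        extendable_mech_language mech_language_witness(2)[OF \<alpha>(1,2)]] bal f_eq by metis
  \<comment> \<open>The two exceptional pairs of images are those of the identity and of
    \<open>E\<close>.\<close>
  then have comp: "comparable (f [A]) (f [B])"
    using f_eq assms(2,3) image2_AB image2_BA by metis
  \<comment> \<open>If both letters were erased, no Sturmian word would have an infinite
    image.\<close>
  have ne: "f [A] \<noteq> [] \<or> f [B] \<noteq> []"
  proof (rule ccontr)
    assume "\<not> (f [A] \<noteq> [] \<or> f [B] \<noteq> [])"
    moreover have "image2 [] [] u = ([] :: letter list)" for u
      by (induction u) (auto split: letter.splits)
    ultimately have "f u = []" for u using f_eq by metis
    moreover have "sturmian (mech_stream \<alpha> 0)" using \<alpha> by (simp add: sturmian_mech_stream)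
    then obtain v where "maps_to f (mech_stream \<alpha> 0) v"
      using assms(1) unfolding sturmian_morphism_def by blast
    ultimately show False unfolding maps_to_def by (metis list.size(3) not_one_le_zero)
  qed
  have pre: "quasiperiodic_morphism f" if "prefix (f [c]) (f [d])" "c \<noteq> d" for c d
  proof (rule quasiperiodic_morphism_if_prefix[OF f _ that(2,1)])
    \<comment> \<open>Only the empty word is a prefix of the empty word, so
      \<open>f [d] = []\<close> would mean that both letters are erased.\<close>
    show "f [d] \<noteq> []" using that ne by (cases c; cases d) auto
  qed
  have suf: "quasiperiodic_morphism f" if "suffix (f [c]) (f [d])" "c \<noteq> d" for c d
  proof (rule quasiperiodic_morphism_if_suffix[OF f _ that(2,1)])
    show "f [d] \<noteq> []" using that ne by (cases c; cases d) auto
  qed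
  show ?thesis
    using comp pre[of A B] pre[of B A] suf[of A B] suf[of B A] unfolding comparable_def by auto
qed

end
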